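(* The state-phase probabilities $p_0(t)$, $p_{n,s}(t)$ of the Erlang queue with multiple arrivals $\{\mathcal{Q}(t)\}_{t\ge 0}$ satisfy, for $t\ge 0$, the following system of difference-differential equations: $$\begin{aligned} \frac{\mathrm d}{\mathrm dt}p_{0}(t)&=-\lambda p_{0}(t)+k\mu p_{1,1}(t),\\ \frac{\mathrm d}{\mathrm dt}p_{1,s}(t)&=-(\lambda+k\mu)p_{1,s}(t)+k\mu p_{1,s+1}(t),\quad 1\le s\le k-1,\\ \frac{\mathrm d}{\mathrm dt}p_{1,k}(t)&=-(\lambda+k\mu)p_{1,k}(t)+k\mu p_{2,1}(t)+\lambda c_1p_0(t),\\ \frac{\mathrm d}{\mathrm dt}p_{n,s}(t)&=-(\lambda+k\mu)p_{n,s}(t)+k\mu p_{n,s+1}(t)+\lambda\sum_{m=1}^{\min\{n,l\}}c_mp_{n-m,s}(t),\quad 1\le s\le k-1,\ n\ge 2,\\ \frac{\mathrm d}{\mathrm dt}p_{n,k}(t)&=-(\lambda+k\mu)p_{n,k}(t)+k\mu p_{n+1,1}(t)+\lambda\sum_{m=1}^{n-1}c_mp_{n-m,k}(t)+\lambda c_np_0(t),\quad 2\le n\le l,\\ \frac{\mathrm d}{\mathrm dt}p_{n,k}(t)&=-(\lambda+k\mu)p_{n,k}(t)+k\mu p_{n+1,1}(t)+\lambda\sum_{m=1}^{l}c_mp_{n-m,k}(t),\quad n>l, \end{aligned}$$ with initial conditions $p_0(0)=1$ and $p_{n,s}(0)=0$ for $1\le s\le k$, $n\ge 1$.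
   Context: Let $k,l\ge 1$ be integers, $\mu>0$, $\lambda_1,\dots,\lambda_l>0$, $\lambda=\lambda_1+\dots+\lambda_l$ and $c_m=\lambda_m/\lambda$ for $1\le m\le l$. The Erlang queue with multiple arrivals is the continuous-time Markov process $\mathcal{Q}(t)=(\mathcal{N}(t),\mathcal{S}(t))$, $t\ge 0$, on the state space $\mathcal{H}_0=\mathcal{H}\cup\{(0,0)\}$, $\mathcal{H}=\{(n,s)\in\mathbb{N}\times\mathbb{N}: n\ge 1,\ 1\le s\le k\}$, with $\mathcal{Q}(0)=(0,0)$. Here $\mathcal{N}(t)$ is the number of customers in a single-channel system and $\mathcal{S}(t)$ is the phase of the customer in service (each service starts in phase $k$, and the phases are counted down to $1$), with $\mathcal{S}(t)=0$ if $\mathcal{N}(t)=0$. Its nonzero transition rates (an event of rate $q$ has probability $qh+o(h)$ in an interval of length $h$) are, for $1\le m\le l$: (arrivals) $(0,0)\to(m,k)$ at rate $\lambda_m=\lambda c_m$, and $(n,s)\to(n+m,s)$ at rate $\lambda_m=\lambda c_m$ for $(n,s)\in\mathcal{H}$; (service, each phase being exponential with mean $1/(k\mu)$) at rate $k\mu$: $(n,s)\to(n,s-1)$ for $n\ge1$, $2\le s\le k$; $(n,1)\to(n-1,k)$ for $n\ge 2$; and $(1,1)\to(0,0)$. The state-phase probabilities are $p_0(t)=\Pr(\mathcal{Q}(t)=(0,0)\mid\mathcal{Q}(0)=(0,0))$ and $p_{n,s}(t)=\Pr(\mathcal{Q}(t)=(n,s)\mid\mathcal{Q}(0)=(0,0))$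 for $(n,s)\in\mathcal{H}$. By convention $p_{0,s}(t)=0$ for $1\le s\le k$. *)

theory Defs
  imports "HOL-Probability.Probability"
begin

(* Conditional probabilities given null events carry no information (they are 0 in HOL),
   so every condition on them is restricted to conditioning events of positive probability.
   In markov, the finite set J of earlier times and the path x range over all
   finite-dimensional pasts. *)
locale homogeneous_markov_process = prob_space M
  for M :: "'w measure" +
  fixes S :: "'s set"
    and X :: "real \<Rightarrow> 'w \<Rightarrow> 's"
  assumes countable_states: "countable S"
    and random_variable_X: "\<And>t. 0 \<le> t \<Longrightarrow> random_variable (count_space S) (X t)"
    and markov: "\<And>J t h x y.
      \<lbrakk>finite J; J \<subseteq> {0..<t}; 0 \<le> t; 0 \<le> h;
       \<P>(w in M. X t w = x t \<and> (\<forall>r\<in>J. X r w = x r)) > 0\<rbrakk> \<Longrightarrow>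
      \<P>(w in M. X (t + h) w = y \<bar> X t w = x t \<and> (\<forall>r\<in>J. X r w = x r)) =
      \<P>(w in M. X (t + h) w = y \<bar> X t w = x t)"
    and homogeneous: "\<And>t t' h x y.
      \<lbrakk>0 \<le> t; 0 \<le> t'; 0 \<le> h; \<P>(w in M. X t w = x) > 0; \<P>(w in M. X t' w = x) > 0\<rbrakk> \<Longrightarrow>
      \<P>(w in M. X (t + h) w = y \<bar> X t w = x) = \<P>(w in M. X (t' + h) w = y \<bar> X t' w = x)"

(* The second condition says that no event happens with probability 1 - (total rate) h + o(h).
   It does not follow from the first one, as S may be infinite and o(h) is not assumed to be
   uniform in the states. *)
definition has_transition_rates ::
  "'w measure \<Rightarrow> 's set \<Rightarrow> (real \<Rightarrow> 'w \<Rightarrow> 's) \<Rightarrow> ('s \<Rightarrow> 's \<Rightarrow> real) \<Rightarrow> bool" where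
  "has_transition_rates M S X q \<longleftrightarrow>
    (\<forall>t\<ge>0. \<forall>x\<in>S. \<P>(w in M. X t w = x) > 0 \<longrightarrow>
      (\<forall>y\<in>S. y \<noteq> x \<longrightarrow>
        (\<lambda>h. \<P>(w in M. X (t + h) w = y \<bar> X t w = x) - q x y * h) \<in> o[at_right 0](\<lambda>h. h)) \<and>
      (\<lambda>h. \<P>(w in M. X (t + h) w = x \<bar> X t w = x) - (1 - (\<Sum>\<^sub>\<infinity>y\<in>S - {x}. q x y) * h))
        \<in> o[at_right 0](\<lambda>h. h))"

definition busy_states :: "nat \<Rightarrow> (nat \<times> nat) set" where
  "busy_states k = {(n, s). 1 \<le> n \<and> 1 \<le> s \<and> s \<le> k}"

definition erlang_states :: "nat \<Rightarrow> (nat \<times> nat) set" where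
  "erlang_states k = busy_states k \<union> {(0, 0)}"

(* At most one of the guards holds for any given pair of states. *)
fun erlang_rate ::
  "nat \<Rightarrow> nat \<Rightarrow> real \<Rightarrow> (nat \<Rightarrow> real) \<Rightarrow> nat \<times> nat \<Rightarrow> nat \<times> nat \<Rightarrow> real" where
  "erlang_rate k l \<mu> lam (n, s) (n', s') =
    (if (n, s) = (0, 0) \<and> 1 \<le> n' \<and> n' \<le> l \<and> s' = k then lam n'
     else if (n, s) \<in> busy_states k \<and> n + 1 \<le> n' \<and> n' \<le> n + l \<and> s' = s then lam (n' - n)
     else if 1 \<le> n \<and> 2 \<le> s \<and> s \<le> k \<and> (n', s') = (n, s - 1) then k * \<mu>
     else if 2 \<le> n \<and> s = 1 \<and> (n', s') = (n - 1, k) then k * \<mu>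
     else if (n, s) = (1, 1) \<and> (n', s') = (0, 0) then k * \<mu>
     else 0)"

locale erlang_queue = homogeneous_markov_process M "erlang_states k" Q
  for M :: "'w measure"
    and k l :: nat
    and \<mu> :: real
    and lam :: "nat \<Rightarrow> real"
    and Q :: "real \<Rightarrow> 'w \<Rightarrow> nat \<times> nat" +
  assumes initial_state: "AE w in M. Q 0 w = (0, 0)"
    and rates: "has_transition_rates M (erlang_states k) Q (erlang_rate k l \<mu> lam)"

definition empty_prob :: "'w measure \<Rightarrow> (real \<Rightarrow> 'w \<Rightarrow> nat \<times> nat) \<Rightarrow> real \<Rightarrow> real" where
  "empty_prob M Q t = \<P>(w in M. Q t w = (0, 0) \<bar> Q 0 w = (0, 0))"

definition state_phase_prob ::
  "'w measure \<Rightarrow> (real \<Rightarrow> 'w \<Rightarrow> nat \<times> nat) \<Rightarrow> nat \<Rightarrow> nat \<Rightarrow> real \<Rightarrow> real" where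
  "state_phase_prob M Q n s t =
    (if n = 0 then 0 else \<P>(w in M. Q t w = (n, s) \<bar> Q 0 w = (0, 0)))"

end

theory Submission
  imports Defs
begin

text \<open>
  The system consists of Kolmogorov's forward equations for the queue, and the whole analytic
  content is one fact about homogeneous Markov processes on a countable state space: if the total
  exit rates are bounded, then the distribution \<open>\<nu>\<^sub>t\<close> of the state at time \<open>t\<close> satisfies
  \<open>\<nu>' = \<nu> G\<close> with \<open>G\<close> the generator. The rates only give the transition probabilities up to an
  \<open>o(h)\<close> that may depend on the state, so exchanging the sum over the infinitely many
  predecessor states with the limit \<open>h \<rightarrow> 0\<close> needs a uniform bound.

  The bound comes from the Markov property. The holding probability \<open>P\<^sub>h(x, x)\<close> is
  supermultiplicative in \<open>h\<close>, so \<open>P\<^sub>h(x, x) \<ge> P\<^sub>d(x, x)^n\<close> with \<open>d = h / n\<close>. For large \<open>n\<close> the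
  right-hand side is at least \<open>(1 - B d)^n \<ge> 1 - B h\<close> by Bernoulli's inequality, where \<open>B\<close> is any
  number above the exit rate of \<open>x\<close> (\<open>trans_prob_diagonal_ge\<close>). Hence
  \<open>\<bar>P\<^sub>h(x, y) - \<delta>\<^sub>x\<^sub>y\<bar> \<le> B h\<close> uniformly in \<open>x\<close> as soon as \<open>B\<close> exceeds all exit rates.

  Writing \<open>\<nu>\<^sub>t\<^sub>+\<^sub>h(y) - \<nu>\<^sub>t(y)\<close> as the expectation of \<open>P\<^sub>h(X\<^sub>t, y) - \<delta>\<close> turns the right derivative into
  an instance of dominated convergence. For the left derivative the expectation is over \<open>X\<close> at
  the earlier time \<open>t - h\<close>. As \<open>X\<close> differs between \<open>t - h\<close> and \<open>t\<close> with probability at most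
  \<open>B h\<close>, replacing one time by the other changes the difference quotient by only \<open>O(h)\<close>
  (\<open>kolmogorov_forward\<close>).

  For the Erlang queue the exit rate is \<open>\<Lambda>\<close> from the empty state and \<open>\<Lambda> + k\<mu>\<close> from a busy one,
  and every state has only finitely many predecessors. Listing them gives the equations.
\<close>

section \<open>Time-independent transition probabilities\<close>

context homogeneous_markov_process
begin

text \<open>
  Conditional probabilities given a null event are 0 and carry no information, so transition
  probabilities are meaningful only from states that the process occupies with positive
  probability at some time.
\<close>
definition reachable :: "'s \<Rightarrow> bool" where
  "reachable x \<longleftrightarrow> (\<exists>t\<ge>0. \<P>(w in M. X t w = x) > 0)"

text \<open>
  By homogeneity every time at which \<open>x\<close> has positive probability gives the same conditional
  probabilities. Choosing one of these times yields a kernel that does not depend on time, which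
  is what allows the distributions at two different times to be compared.
\<close>
definition trans_prob :: "real \<Rightarrow> 's \<Rightarrow> 's \<Rightarrow> real" where
  "trans_prob h x y =
    (let t = SOME t. t \<ge> 0 \<and> \<P>(w in M. X t w = x) > 0
     in \<P>(w in M. X (t + h) w = y \<bar> X t w = x))"

lemma borel_measurable_fun_state [measurable]:
  assumes "t \<ge> 0"
  shows "(\<lambda>w. f (X t w) :: 'b :: topological_space) \<in> borel_measurable M"
  by (rule measurable_compose[OF random_variable_X[OF assms]]) simp

lemma state_in_S: "t \<ge> 0 \<Longrightarrow> w \<in> space M \<Longrightarrow> X t w \<in> S"
  using measurable_space[OF random_variable_X, of t w] by simp

lemma pred_state [measurable]:
  assumes "t \<ge> 0"
  shows "Measurable.pred M (\<lambda>w. P (X t w))"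
  by (rule measurable_compose[OF random_variable_X[OF assms]]) simp

lemma events_state: "t \<ge> 0 \<Longrightarrow> {w \<in> space M. P (X t w)} \<in> events"
  by measurable

text \<open>
  Countability of the state space matters here: the event is a union over the possible states at
  time \<open>t\<close>, and only a countable union of events is certain to be an event.
\<close>
lemma pred_two_states [measurable]:
  assumes "t \<ge> 0" "u \<ge> 0"
  shows "Measurable.pred M (\<lambda>w. X u w = g (X t w))"
proof -
  have "(\<lambda>w. X u w = g (X t w)) \<in> M \<rightarrow>\<^sub>M count_space UNIV \<longleftrightarrow>
        (\<lambda>w. \<exists>x\<in>S. X t w = x \<and> X u w = g x) \<in> M \<rightarrow>\<^sub>M count_space UNIV"
    by (rule measurable_cong) (auto dest: state_in_S[OF assms(1)])
  also have "\<dots>"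
    using assms countable_states by measurable
  finally show ?thesis .
qed

lemma trans_prob_eq:
  assumes "t \<ge> 0" "h \<ge> 0" "\<P>(w in M. X t w = x) > 0"
  shows "\<P>(w in M. X (t + h) w = y \<bar> X t w = x) = trans_prob h x y"
proof -
  define u where "u = (SOME t. t \<ge> 0 \<and> \<P>(w in M. X t w = x) > 0)"
  have "u \<ge> 0 \<and> \<P>(w in M. X u w = x) > 0"
    unfolding u_def by (rule someI[of _ t]) (use assms in auto)
  then show ?thesis
    unfolding trans_prob_def u_def[symmetric] Let_def
    using assms by (intro homogeneous) auto
qed

text \<open>
  The product form stays valid when \<open>x\<close> has probability 0 at time \<open>t\<close>, so that sums over all
  states need no case distinction.
\<close>
lemma joint_prob:
  assumes "t \<ge> 0" "h \<ge> 0"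
  shows "\<P>(w in M. X t w = x \<and> X (t + h) w = y) = \<P>(w in M. X t w = x) * trans_prob h x y"
proof (cases "\<P>(w in M. X t w = x) > 0")
  case True
  then show ?thesis
    using trans_prob_eq[OF assms True, of y] by (simp add: cond_prob_def field_simps conj_commute)
next
  case False
  then have 0: "\<P>(w in M. X t w = x) = 0"
    using measure_nonneg[of M "{w \<in> space M. X t w = x}"] by linarith
  have "\<P>(w in M. X t w = x \<and> X (t + h) w = y) \<le> \<P>(w in M. X t w = x)"
    by (intro finite_measure_mono events_state) (use assms in auto)
  then have "\<P>(w in M. X t w = x \<and> X (t + h) w = y) = 0"
    unfolding 0 by (intro antisym measure_nonneg)
  then show ?thesis using 0 by simp
qed

lemma reachableE:
  assumes "reachable x"
  obtains t where "t \<ge> 0" "\<P>(w in M. X t w = x) > 0"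
  using assms unfolding reachable_def by blast

lemma trans_prob_nonneg: "trans_prob h x y \<ge> 0"
  by (simp add: trans_prob_def cond_prob_def Let_def)

lemma trans_prob_off_diagonal_le:
  assumes "reachable x" "h \<ge> 0" "x \<noteq> y"
  shows "trans_prob h x x + trans_prob h x y \<le> 1"
proof -
  obtain t where t: "t \<ge> 0" "\<P>(w in M. X t w = x) > 0"
    using assms(1) by (rule reachableE)
  have m: "{w \<in> space M. X t w = x \<and> X (t + h) w = z} \<in> events" for z
    using t assms by (intro sets.sets_Collect_conj events_state) auto
  have "\<P>(w in M. X t w = x \<and> X (t + h) w = x) + \<P>(w in M. X t w = x \<and> X (t + h) w = y)
      = prob ({w \<in> space M. X t w = x \<and> X (t + h) w = x} \<union> {w \<in> space M. X t w = x \<and> X (t + h) w = y})"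
    using assms m by (intro finite_measure_Union[symmetric]) auto
  also have "\<dots> \<le> \<P>(w in M. X t w = x)"
    by (intro finite_measure_mono events_state) (use t in auto)
  finally have "\<P>(w in M. X t w = x) * (trans_prob h x x + trans_prob h x y) \<le> \<P>(w in M. X t w = x) * 1"
    using t assms by (simp add: joint_prob distrib_left)
  then show ?thesis using t(2) by (simp only: mult_le_cancel_left_pos)
qed

lemma trans_prob_le_1:
  assumes "h \<ge> 0" "reachable x"
  shows "trans_prob h x y \<le> 1"
proof -
  obtain t where t: "t \<ge> 0" "\<P>(w in M. X t w = x) > 0"
    using assms(2) by (rule reachableE)
  show ?thesis
    unfolding trans_prob_eq[OF t(1) assms(1) t(2), symmetric]
    using t(2) by (auto simp: cond_prob_def divide_le_eq_1 intro!: finite_measure_mono events_state[OF t(1)])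
qed

text \<open>
  One way of being in \<open>x\<close> again after time \<open>s + h\<close> is to be there also after time \<open>s\<close>. This is
  where the Markov property enters, with the single past time at which the process starts in \<open>x\<close>.
\<close>
lemma trans_prob_diagonal_supermult:
  assumes "reachable x" "s \<ge> 0" "h \<ge> 0"
  shows "trans_prob s x x * trans_prob h x x \<le> trans_prob (s + h) x x"
proof (cases "s = 0 \<or> trans_prob s x x = 0")
  case True
  then show ?thesis
  proof
    assume "s = 0"
    then show ?thesis
      using mult_right_mono[OF trans_prob_le_1[OF assms(2,1), of x] trans_prob_nonneg[of h x x]] by simp
  qed (simp add: trans_prob_nonneg)
next
  case False
  obtain t where t: "t \<ge> 0" "\<P>(w in M. X t w = x) > 0"
    using assms(1) by (rule reachableE)
  have joint: "\<P>(w in M. X t w = x \<and> X (t + s) w = x) = \<P>(w in M. X t w = x) * trans_prob s x x"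
    using t assms by (intro joint_prob)
  have pos: "\<P>(w in M. X t w = x \<and> X (t + s) w = x) > 0"
    unfolding joint using t False trans_prob_nonneg[of s x x] by (intro mult_pos_pos) auto
  have "\<P>(w in M. X t w = x \<and> X (t + s) w = x) \<le> \<P>(w in M. X (t + s) w = x)"
    by (intro finite_measure_mono events_state) (use t assms in auto)
  with pos have pos': "\<P>(w in M. X (t + s) w = x) > 0" by linarith
  have "\<P>(w in M. X (t + s + h) w = x \<bar> X (t + s) w = x \<and> (\<forall>r\<in>{t}. X r w = x)) =
        \<P>(w in M. X (t + s + h) w = x \<bar> X (t + s) w = x)"
    using markov[of "{t}" "t + s" h "\<lambda>_. x" x] t assms False pos by (simp add: conj_commute)
  also have "\<dots> = trans_prob h x x"
    using t assms pos' by (intro trans_prob_eq) auto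
  finally have "\<P>(w in M. X (t + s + h) w = x \<and> X (t + s) w = x \<and> X t w = x) =
        \<P>(w in M. X t w = x \<and> X (t + s) w = x) * trans_prob h x x"
    using pos by (simp add: cond_prob_def field_simps conj_commute)
  then have "\<P>(w in M. X t w = x) * (trans_prob s x x * trans_prob h x x) =
        \<P>(w in M. X (t + s + h) w = x \<and> X (t + s) w = x \<and> X t w = x)"
    by (simp add: joint)
  also have "\<dots> \<le> \<P>(w in M. X t w = x \<and> X (t + (s + h)) w = x)"
    by (rule finite_measure_mono) (use t assms in \<open>auto simp: add.assoc\<close>)
  also have "\<dots> = \<P>(w in M. X t w = x) * trans_prob (s + h) x x"
    using t assms by (intro joint_prob) auto
  finally show ?thesis using t(2) by (simp only: mult_le_cancel_left_pos)
qed

lemma trans_prob_diagonal_power_le: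
  assumes "reachable x" "h \<ge> 0"
  shows "trans_prob h x x ^ Suc n \<le> trans_prob (real (Suc n) * h) x x"
proof (induction n)
  case (Suc n)
  have "trans_prob h x x ^ Suc (Suc n) = trans_prob h x x ^ Suc n * trans_prob h x x"
    by (simp only: power_Suc2)
  also have "\<dots> \<le> trans_prob (real (Suc n) * h) x x * trans_prob h x x"
    by (intro mult_right_mono Suc.IH trans_prob_nonneg)
  also have "\<dots> \<le> trans_prob (real (Suc n) * h + h) x x"
    using assms by (intro trans_prob_diagonal_supermult) auto
  also have "real (Suc n) * h + h = real (Suc (Suc n)) * h"
    by (simp add: algebra_simps)
  finally show ?case .
qed simp

text \<open>
  A first-order expansion at 0 becomes an inequality for all \<open>h\<close>: splitting \<open>h\<close> into many short
  steps brings each step into the range where the expansion is accurate, and Bernoulli's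
  inequality recombines the steps with the same constant. The only demand that \<open>x\<close> makes on \<open>B\<close> is
  \<open>e < B\<close>, which is the source of all uniformity below.
\<close>
lemma trans_prob_diagonal_ge:
  assumes x: "reachable x" and h: "h \<ge> 0"
    and lim: "((\<lambda>h. (trans_prob h x x - 1) / h) \<longlongrightarrow> - e) (at_right 0)"
    and B: "e < B" "B \<ge> 0"
  shows "1 - B * h \<le> trans_prob h x x"
proof (cases "B * h \<ge> 1 \<or> h = 0")
  case True
  have "1 \<le> trans_prob 0 x x"
  proof -
    obtain t where t: "t \<ge> 0" "\<P>(w in M. X t w = x) > 0"
      using x by (rule reachableE)
    then show ?thesis using trans_prob_eq[of t 0 x x] by (simp add: cond_prob_def)
  qed
  then show ?thesis using True trans_prob_nonneg[of h x x] by auto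
next
  case False
  then have h: "h > 0" and Bh: "B * h < 1" using h by auto
  have "\<forall>\<^sub>F d in at_right 0. - B < (trans_prob d x x - 1) / d"
    using lim B by (intro order_tendstoD) auto
  moreover have "filterlim (\<lambda>n. h / real (Suc n)) (at_right 0) sequentially"
    using h by (intro filterlim_atI tendsto_divide_0[OF tendsto_const] filterlim_compose[OF filterlim_real_sequentially filterlim_Suc] always_eventually
       tendsto_imp_filterlim_at_right filterlim_at_top_imp_at_infinity) auto
  ultimately have "\<forall>\<^sub>F n in sequentially. - B < (trans_prob (h / real (Suc n)) x x - 1) / (h / real (Suc n))"
    by (rule eventually_compose_filterlim)
  then obtain n where n: "- B < (trans_prob (h / real (Suc n)) x x - 1) / (h / real (Suc n))"
    by (auto simp only: eventually_sequentially)
  define d where "d = h / real (Suc n)"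
  have d: "d > 0" "real (Suc n) * d = h" using h by (auto simp: d_def)
  have "d \<le> h" unfolding d_def using h by (simp add: field_simps)
  then have "B * d \<le> 1" using mult_left_mono[of d h B] B Bh by linarith
  have step: "1 - B * d \<le> trans_prob d x x"
    using n d(1) unfolding d_def[symmetric] by (simp add: field_simps)
  have "1 - B * h = 1 + real (Suc n) * (- (B * d))"
    unfolding d(2)[symmetric] by (simp add: algebra_simps)
  also have "\<dots> \<le> (1 + (- (B * d))) ^ Suc n"
    using \<open>B * d \<le> 1\<close> by (intro Bernoulli_inequality) auto
  also have "\<dots> \<le> trans_prob d x x ^ Suc n"
    using step \<open>B * d \<le> 1\<close> by (intro power_mono) auto
  also have "\<dots> \<le> trans_prob h x x"
    using trans_prob_diagonal_power_le[OF x, of d n] d by simp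
  finally show ?thesis .
qed

lemma AE_reachable:
  assumes "t \<ge> 0"
  shows "AE w in M. reachable (X t w)"
proof -
  have "AE w in M. X t w = x \<longrightarrow> reachable x" for x
  proof (cases "reachable x")
    case False
    then have "\<P>(w in M. X t w = x) = 0"
      using assms measure_nonneg[of M "{w \<in> space M. X t w = x}"]
      unfolding reachable_def by (metis less_eq_real_def)
    then have "AE w in M. \<not> X t w = x"
      using assms prob_Collect_eq_0[of "\<lambda>w. X t w = x"] events_state[OF assms] by simp
    then show ?thesis by eventually_elim auto
  qed auto
  then have "AE w in M. \<forall>x\<in>S. X t w = x \<longrightarrow> reachable x"
    by (subst AE_ball_countable[OF countable_states]) blast
  then show ?thesis
    using AE_space by eventually_elim (auto dest: state_in_S[OF assms])
qed

text \<open>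
  Conditioning on the state at time \<open>t\<close>. A constant \<open>g\<close> gives the distribution at time \<open>t + h\<close>,
  and the identity gives the probability that the state is the same at both times. Both sides are
  the sum over \<open>x\<close> of \<open>\<P>(X t = x) * trans_prob h x (g x)\<close>.
\<close>
lemma prob_next_state:
  assumes "t \<ge> 0" "h \<ge> 0"
  shows "\<P>(w in M. X (t + h) w = g (X t w)) = (\<integral>w. trans_prob h (X t w) (g (X t w)) \<partial>M)"
proof -
  have th: "t + h \<ge> 0" using assms by simp
  note [measurable] = pred_state[OF th] pred_state[OF assms(1)]
  have rm: "emeasure M {w \<in> space M. X t w = x \<and> X (t + h) w = g x} =
       ennreal (trans_prob h x (g x)) * emeasure M {w \<in> space M. X t w = x}" for x
    using joint_prob[OF assms, of x "g x"]
    by (simp add: emeasure_eq_measure ennreal_mult' trans_prob_nonneg mult.commute)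
  have "emeasure M {w \<in> space M. X (t + h) w = g (X t w)} =
    emeasure M (\<Union>x\<in>S. {w \<in> space M. X t w = x \<and> X (t + h) w = g x})"
    by (rule arg_cong[where f = "emeasure M"]) (auto dest: state_in_S[OF assms(1)])
  also have "\<dots> = (\<integral>\<^sup>+x. emeasure M {w \<in> space M. X t w = x \<and> X (t + h) w = g x} \<partial>count_space S)"
    using assms countable_states
    by (intro emeasure_UN_countable) (auto simp: disjoint_family_on_def)
  also have "\<dots> = (\<integral>\<^sup>+x. (\<integral>\<^sup>+w. ennreal (trans_prob h x (g x)) * indicator {w \<in> space M. X t w = x} w \<partial>M) \<partial>count_space S)"
    unfolding rm using assms by (simp add: nn_integral_cmult_indicator events_state)
  also have "\<dots> = (\<integral>\<^sup>+w. (\<integral>\<^sup>+x. ennreal (trans_prob h x (g x)) * indicator {w \<in> space M. X t w = x} w \<partial>count_space S) \<partial>M)"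
    using assms countable_states by (intro nn_integral_count_space_nn_integral[symmetric]) auto
  also have "\<dots> = (\<integral>\<^sup>+w. ennreal (trans_prob h (X t w) (g (X t w))) \<partial>M)"
  proof (rule nn_integral_cong)
    fix w assume w: "w \<in> space M"
    have "(\<integral>\<^sup>+x. ennreal (trans_prob h x (g x)) * indicator {w \<in> space M. X t w = x} w \<partial>count_space S)
       = (\<integral>\<^sup>+x. ennreal (trans_prob h (X t w) (g (X t w))) * indicator {X t w} x \<partial>count_space S)"
      by (rule nn_integral_cong) (use w in \<open>auto simp: indicator_def\<close>)
    also have "\<dots> = ennreal (trans_prob h (X t w) (g (X t w)))"
      using state_in_S[OF assms(1) w] by (simp add: nn_integral_cmult_indicator)
    finally show "(\<integral>\<^sup>+x. ennreal (trans_prob h x (g x)) * indicator {w \<in> space M. X t w = x} w \<partial>count_space S)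
       = ennreal (trans_prob h (X t w) (g (X t w)))" .
  qed
  finally show ?thesis
    using assms by (subst integral_eq_nn_integral)
      (auto simp: trans_prob_nonneg measure_def borel_measurable_fun_state)
qed

lemma reachable_in_S: "reachable x \<Longrightarrow> x \<in> S"
proof (erule reachableE)
  fix t assume t: "t \<ge> 0" "\<P>(w in M. X t w = x) > 0"
  then have "{w \<in> space M. X t w = x} \<noteq> {}" by (metis less_irrefl measure_empty)
  then show "x \<in> S" using state_in_S[OF t(1)] by blast
qed

end

section \<open>The forward equation for bounded exit rates\<close>

text \<open>
  The infinitesimal generator belonging to the jump rates \<open>q\<close>: its entries are the derivatives
  at \<open>h = 0\<close> of the transition probabilities from reachable states, so the diagonal carries the negative exit rates.
\<close>
definition generator :: "'s set \<Rightarrow> ('s \<Rightarrow> 's \<Rightarrow> real) \<Rightarrow> 's \<Rightarrow> 's \<Rightarrow> real" where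
  "generator S q x y = (if x = y then - (\<Sum>\<^sub>\<infinity>z\<in>S - {x}. q x z) else q x y)"

context homogeneous_markov_process
begin

definition increment :: "real \<Rightarrow> 's \<Rightarrow> 's \<Rightarrow> real" where
  "increment h y x = trans_prob h x y - of_bool (x = y)"

text \<open>
  The constant \<open>B\<close> lies strictly above all exit rates, because the expansion of the holding
  probability gives only \<open>P\<^sub>h(x, x) \<ge> 1 - B h\<close> for \<open>B\<close> greater than the exit rate of \<open>x\<close>.
\<close>
context
  fixes q :: "'s \<Rightarrow> 's \<Rightarrow> real" and B :: real
  assumes rates: "has_transition_rates M S X q"
    and exit_rate_less: "\<And>x. x \<in> S \<Longrightarrow> (\<Sum>\<^sub>\<infinity>y\<in>S - {x}. q x y) < B"
    and B_nonneg: "B \<ge> 0"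
begin

lemma increment_limit:
  assumes x: "reachable x" and y: "y \<in> S"
  shows "((\<lambda>h. increment h y x / h) \<longlongrightarrow> generator S q x y) (at_right 0)"
proof -
  obtain t where t: "t \<ge> 0" "\<P>(w in M. X t w = x) > 0"
    using x by (rule reachableE)
  have "((\<lambda>h. (increment h y x - generator S q x y * h) / h) \<longlongrightarrow> 0) (at_right 0)"
  proof (cases "x = y")
    case True
    have "(\<lambda>h. \<P>(w in M. X (t + h) w = x \<bar> X t w = x) - (1 - (\<Sum>\<^sub>\<infinity>y\<in>S - {x}. q x y) * h))
        \<in> o[at_right 0](\<lambda>h. h)"
      using rates[unfolded has_transition_rates_def, rule_format, OF t(1) reachable_in_S[OF x] t(2)]
      by simp
    from smalloD_tendsto[OF this] show ?thesis
    proof (rule Lim_transform_eventually)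
      show "\<forall>\<^sub>F h in at_right 0.
        (\<P>(w in M. X (t + h) w = x \<bar> X t w = x) - (1 - (\<Sum>\<^sub>\<infinity>y\<in>S - {x}. q x y) * h)) / h
          = (increment h y x - generator S q x y * h) / h"
        using eventually_at_right_less[of "0 :: real"]
      proof eventually_elim
        case (elim h)
        have "\<P>(w in M. X (t + h) w = x \<bar> X t w = x) = trans_prob h x x"
          using t elim by (intro trans_prob_eq) auto
        with True show ?case by (simp add: increment_def generator_def)
      qed
    qed
  next
    case False
    have "(\<lambda>h. \<P>(w in M. X (t + h) w = y \<bar> X t w = x) - q x y * h) \<in> o[at_right 0](\<lambda>h. h)"
      using rates[unfolded has_transition_rates_def, rule_format, OF t(1) reachable_in_S[OF x] t(2)] y False
      by simp
    from smalloD_tendsto[OF this] show ?thesis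
    proof (rule Lim_transform_eventually)
      show "\<forall>\<^sub>F h in at_right 0.
        (\<P>(w in M. X (t + h) w = y \<bar> X t w = x) - q x y * h) / h
          = (increment h y x - generator S q x y * h) / h"
        using eventually_at_right_less[of "0 :: real"]
      proof eventually_elim
        case (elim h)
        have "\<P>(w in M. X (t + h) w = y \<bar> X t w = x) = trans_prob h x y"
          using t elim by (intro trans_prob_eq) auto
        with False show ?case by (simp add: increment_def generator_def)
      qed
    qed
  qed
  from tendsto_add[OF this tendsto_const[of "generator S q x y"]]
  have "((\<lambda>h. (increment h y x - generator S q x y * h) / h + generator S q x y) \<longlongrightarrow> generator S q x y) (at_right 0)"
    by simp
  then show ?thesis
  proof (rule Lim_transform_eventually)
    show "\<forall>\<^sub>F h in at_right 0.
      (increment h y x - generator S q x y * h) / h + generator S q x y = increment h y x / h"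
      using eventually_at_right_less[of "0 :: real"] by eventually_elim (simp add: diff_divide_distrib)
  qed
qed

lemma uniform_holding_prob:
  assumes x: "reachable x" and h: "h \<ge> 0"
  shows "1 - B * h \<le> trans_prob h x x"
proof (rule trans_prob_diagonal_ge[OF x h])
  show "((\<lambda>h. (trans_prob h x x - 1) / h) \<longlongrightarrow> - (\<Sum>\<^sub>\<infinity>y\<in>S - {x}. q x y)) (at_right 0)"
    using increment_limit[OF x reachable_in_S[OF x]] by (simp add: increment_def generator_def)
qed (use exit_rate_less reachable_in_S x B_nonneg in auto)

text \<open>
  Off the diagonal, the probability of moving to \<open>y\<close> is at most that of leaving \<open>x\<close>, so the bound
  on holding probabilities controls every entry.
\<close>
lemma increment_bound:
  assumes x: "reachable x" and h: "h \<ge> 0"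
  shows "\<bar>increment h y x\<bar> \<le> B * h"
proof (cases "x = y")
  case True
  then show ?thesis
    using uniform_holding_prob[OF assms] trans_prob_le_1[OF h x, of y] by (auto simp: increment_def)
next
  case False
  then show ?thesis
    using uniform_holding_prob[OF assms] trans_prob_off_diagonal_le[OF x h False]
      trans_prob_nonneg[of h x y] by (auto simp: increment_def)
qed

lemma integrable_increment:
  assumes "t \<ge> 0" "h \<ge> 0"
  shows "integrable M (\<lambda>w. increment h y (X t w))"
proof (rule integrable_const_bound[where B = "B * h"])
  show "AE w in M. norm (increment h y (X t w)) \<le> B * h"
    using AE_reachable[OF assms(1)] by eventually_elim (use increment_bound assms in auto)
qed (use assms borel_measurable_fun_state in auto)

lemma expectation_increment:
  assumes "t \<ge> 0" "h \<ge> 0"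
  shows "(\<integral>w. increment h y (X t w) \<partial>M) = \<P>(w in M. X (t + h) w = y) - \<P>(w in M. X t w = y)"
proof -
  have eq: "of_bool (X t w = y) = indicator {w \<in> space M. X t w = y} w" if "w \<in> space M" for w
    using that by (auto simp: indicator_def)
  have int: "integrable M (\<lambda>w. of_bool (X t w = y) :: real)"
    using events_state[OF assms(1), of "\<lambda>x. x = y"]
    by (subst Bochner_Integration.integrable_cong[OF refl eq]) (auto simp: emeasure_eq_measure)
  have "(\<integral>w. of_bool (X t w = y) \<partial>M) = \<P>(w in M. X t w = y)"
    using events_state[OF assms(1), of "\<lambda>x. x = y"]
    by (subst Bochner_Integration.integral_cong[OF refl eq]) auto
  moreover have "integrable M (\<lambda>w. trans_prob h (X t w) y)"
    using Bochner_Integration.integrable_add[OF integrable_increment[OF assms, of y] int]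
    by (simp add: increment_def)
  ultimately show ?thesis
    using prob_next_state[OF assms, of "\<lambda>_. y"] int by (simp add: increment_def)
qed

lemma prob_state_change:
  assumes "t \<ge> 0" "h \<ge> 0"
  shows "\<P>(w in M. X (t + h) w \<noteq> X t w) \<le> B * h"
proof -
  have ev: "{w \<in> space M. X (t + h) w = X t w} \<in> events"
    using pred_two_states[of t "t + h" "\<lambda>x. x"] assms by (simp add: pred_def)
  have "1 - B * h = (\<integral>w. 1 - B * h \<partial>M)"
    by (simp add: prob_space)
  also have "\<dots> \<le> (\<integral>w. trans_prob h (X t w) (X t w) \<partial>M)"
  proof (rule integral_mono_AE)
    show "integrable M (\<lambda>w. trans_prob h (X t w) (X t w))"
    proof (rule integrable_const_bound[where B = 1])
      show "AE w in M. norm (trans_prob h (X t w) (X t w)) \<le> 1"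
        using AE_reachable[OF assms(1)]
        by eventually_elim (use trans_prob_le_1 trans_prob_nonneg assms in auto)
    qed (use assms borel_measurable_fun_state in auto)
    show "AE w in M. 1 - B * h \<le> trans_prob h (X t w) (X t w)"
      using AE_reachable[OF assms(1)] by eventually_elim (use uniform_holding_prob assms in auto)
  qed auto
  also have "\<dots> = \<P>(w in M. X (t + h) w = X t w)"
    using prob_next_state[OF assms, of "\<lambda>x. x"] by simp
  finally show ?thesis
    using prob_neg[OF ev] by simp
qed

text \<open>
  Both expectations have the same integrand except where the state changes. That event has
  probability at most \<open>B h\<close>, and there the integrands differ by at most \<open>2 B h\<close>. The result is of
  second order, so it disappears from the difference quotient.
\<close>
lemma expectation_increment_diff:
  assumes "t \<ge> 0" "h \<ge> 0"
  shows "\<bar>(\<integral>w. increment h y (X (t + h) w) \<partial>M) - (\<integral>w. increment h y (X t w) \<partial>M)\<bar> \<le> 2 * (B * h)\<^sup>2"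
proof -
  have th: "t + h \<ge> 0" using assms by simp
  define D where "D w = increment h y (X (t + h) w) - increment h y (X t w)" for w
  define A where "A = {w \<in> space M. X (t + h) w \<noteq> X t w}"
  have A: "A \<in> events"
    unfolding A_def
    by (intro sets.sets_Collect_neg)
      (use pred_two_states[OF assms(1) th, of "\<lambda>x. x"] in \<open>simp add: pred_def\<close>)
  have D: "integrable M D"
    unfolding D_def using integrable_increment assms by auto
  have "\<bar>(\<integral>w. D w \<partial>M)\<bar> \<le> (\<integral>w. \<bar>D w\<bar> \<partial>M)"
    by (rule integral_abs_bound)
  also have "\<dots> \<le> (\<integral>w. 2 * (B * h) * indicator A w \<partial>M)"
  proof (rule integral_mono_AE)
    show "AE w in M. \<bar>D w\<bar> \<le> 2 * (B * h) * indicator A w"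
      using AE_reachable[OF assms(1)] AE_reachable[OF th] AE_space
    proof eventually_elim
      case (elim w)
      then show ?case
        using increment_bound[OF elim(1) assms(2), of y] increment_bound[OF elim(2) assms(2), of y]
        by (auto simp: D_def A_def indicator_def)
    qed
  qed (use D A in \<open>auto simp: emeasure_eq_measure\<close>)
  also have "\<dots> = 2 * (B * h) * prob A"
    using A by simp
  also have "\<dots> \<le> 2 * (B * h) * (B * h)"
    using prob_state_change[OF assms] B_nonneg assms unfolding A_def by (intro mult_left_mono) auto
  finally show ?thesis
    using integrable_increment[OF assms, of y] integrable_increment[OF th assms(2), of y]
    by (simp add: D_def power2_eq_square)
qed

lemma expectation_increment_limit:
  assumes t: "t \<ge> 0" and y: "y \<in> S"
  shows "((\<lambda>h. (\<integral>w. increment h y (X t w) / h \<partial>M)) \<longlongrightarrow> (\<integral>w. generator S q (X t w) y \<partial>M)) (at_right 0)"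
proof (rule tendsto_at_right_sequentially[of 0 1])
  fix s :: "nat \<Rightarrow> real" assume s: "\<And>n. 0 < s n" "s \<longlonglongrightarrow> 0"
  have lim: "filterlim s (at_right 0) sequentially"
    using s by (intro tendsto_imp_filterlim_at_right) auto
  show "(\<lambda>n. \<integral>w. increment (s n) y (X t w) / s n \<partial>M) \<longlonglongrightarrow> (\<integral>w. generator S q (X t w) y \<partial>M)"
  proof (rule integral_dominated_convergence)
    show "AE w in M. (\<lambda>n. increment (s n) y (X t w) / s n) \<longlonglongrightarrow> generator S q (X t w) y"
      using AE_reachable[OF t]
      by eventually_elim (rule filterlim_compose[OF increment_limit[OF _ y] lim])
    show "AE w in M. norm (increment (s n) y (X t w) / s n) \<le> B" for n
      using AE_reachable[OF t]
    proof eventually_elim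
      case (elim w)
      then show ?case
        using increment_bound[OF elim, of "s n" y] s(1)[of n] by (simp add: field_simps)
    qed
  qed (use t borel_measurable_fun_state in \<open>auto intro: borel_measurable_fun_state[OF t]\<close>)
qed simp

text \<open>
  The difference quotient between \<open>s\<close> and \<open>t\<close> is the expected increment over a time \<open>\<bar>s - t\<bar>\<close>
  from the earlier of the two times, divided by \<open>\<bar>s - t\<bar>\<close>. Comparing it with the same quotient
  from \<open>t\<close> treats both sides of \<open>t\<close> at once: for \<open>s > t\<close> they agree, and for \<open>s < t\<close> they differ
  by at most \<open>2 B\<^sup>2 \<bar>s - t\<bar>\<close>.
\<close>
theorem kolmogorov_forward:
  assumes t: "t \<ge> 0" and y: "y \<in> S"
  shows "((\<lambda>t. \<P>(w in M. X t w = y)) has_real_derivative (\<integral>w. generator S q (X t w) y \<partial>M))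
           (at t within {0..})"
proof -
  define \<nu> where "\<nu> t = \<P>(w in M. X t w = y)" for t
  define E where "E u h = (\<integral>w. increment h y (X u w) \<partial>M)" for u h
  have inc: "\<nu> (u + h) - \<nu> u = E u h" if "u \<ge> 0" "h \<ge> 0" for u h
    unfolding \<nu>_def E_def using that by (simp add: expectation_increment)
  have F: "filterlim (\<lambda>s. \<bar>s - t\<bar>) (at_right 0) (at t within {0..})"
    by (intro tendsto_imp_filterlim_at_right)
      (auto simp: eventually_at_filter intro!: tendsto_eq_intros always_eventually)
  have "((\<lambda>s. E t \<bar>s - t\<bar> / \<bar>s - t\<bar>) \<longlongrightarrow> (\<integral>w. generator S q (X t w) y \<partial>M)) (at t within {0..})"
    using filterlim_compose[OF expectation_increment_limit[OF t y] F] by (simp add: E_def)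
  moreover have "((\<lambda>s. (\<nu> s - \<nu> t) / (s - t) - E t \<bar>s - t\<bar> / \<bar>s - t\<bar>) \<longlongrightarrow> 0) (at t within {0..})"
  proof (rule Lim_null_comparison)
    show "((\<lambda>s. 2 * B\<^sup>2 * \<bar>s - t\<bar>) \<longlongrightarrow> 0) (at t within {0..})"
      by (auto intro!: tendsto_eq_intros)
    have "norm ((\<nu> s - \<nu> t) / (s - t) - E t \<bar>s - t\<bar> / \<bar>s - t\<bar>) \<le> 2 * B\<^sup>2 * \<bar>s - t\<bar>"
      if "s \<ge> 0" "s \<noteq> t" for s
    proof (cases "s > t")
      case True
      then show ?thesis using inc[of t "s - t"] t by simp
    next
      case False
      define h where "h = t - s"
      have h: "h > 0" "s + h = t" "\<bar>s - t\<bar> = h" using False that by (auto simp: h_def)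
      have slope: "(\<nu> s - \<nu> t) / (s - t) = E s h / h"
        using inc[of s h] that h by (simp add: h_def field_simps)
      have "norm ((\<nu> s - \<nu> t) / (s - t) - E t \<bar>s - t\<bar> / \<bar>s - t\<bar>) = \<bar>E t h - E s h\<bar> / h"
        unfolding slope h(3) using h(1) by (simp flip: diff_divide_distrib add: abs_minus_commute)
      also have "\<dots> \<le> 2 * (B * h)\<^sup>2 / h"
        using expectation_increment_diff[of s h y] that h by (intro divide_right_mono) (auto simp: E_def)
      also have "\<dots> = 2 * B\<^sup>2 * \<bar>s - t\<bar>"
        unfolding h(3) using h(1) by (simp add: power2_eq_square)
      finally show ?thesis .
    qed
    then show "\<forall>\<^sub>F s in at t within {0..}.
      norm ((\<nu> s - \<nu> t) / (s - t) - E t \<bar>s - t\<bar> / \<bar>s - t\<bar>) \<le> 2 * B\<^sup>2 * \<bar>s - t\<bar>"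
      by (auto simp: eventually_at_filter intro!: always_eventually)
  qed
  ultimately have "((\<lambda>s. (\<nu> s - \<nu> t) / (s - t)) \<longlongrightarrow> (\<integral>w. generator S q (X t w) y \<partial>M)) (at t within {0..})"
    using tendsto_add by fastforce
  then show ?thesis
    unfolding has_field_derivative_iff \<nu>_def .
qed

text \<open>
  If only finitely many states lead to \<open>y\<close>, the expectation is a finite sum, the balance of inflow
  and outflow.
\<close>
corollary kolmogorov_forward_finite:
  assumes t: "t \<ge> 0" and y: "y \<in> S"
    and A: "finite A" "A \<subseteq> S - {y}"
    and no_other: "\<And>x. x \<in> S \<Longrightarrow> x \<noteq> y \<Longrightarrow> x \<notin> A \<Longrightarrow> q x y = 0"
  shows "((\<lambda>t. \<P>(w in M. X t w = y)) has_real_derivative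
      ((\<Sum>x\<in>A. q x y * \<P>(w in M. X t w = x)) - (\<Sum>\<^sub>\<infinity>x\<in>S - {y}. q y x) * \<P>(w in M. X t w = y)))
           (at t within {0..})"
proof -
  define I where "I x = (indicator {w \<in> space M. X t w = x} :: _ \<Rightarrow> real)" for x
  have I: "integrable M (I x)" "(\<integral>w. I x w \<partial>M) = \<P>(w in M. X t w = x)" for x
    using events_state[OF t, of "\<lambda>z. z = x"] by (auto simp: I_def emeasure_eq_measure)
  have "(\<integral>w. generator S q (X t w) y \<partial>M) =
    (\<integral>w. (\<Sum>x\<in>A. q x y * I x w) - (\<Sum>\<^sub>\<infinity>x\<in>S - {y}. q y x) * I y w \<partial>M)"
  proof (rule Bochner_Integration.integral_cong[OF refl])
    fix w assume w: "w \<in> space M"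
    have "(\<Sum>x\<in>A. q x y * I x w) = (\<Sum>x\<in>A. if x = X t w then q x y else 0)"
      using w by (intro sum.cong) (auto simp: I_def)
    also have "\<dots> = (if X t w \<in> A then q (X t w) y else 0)"
      using A by simp
    finally show "generator S q (X t w) y =
        (\<Sum>x\<in>A. q x y * I x w) - (\<Sum>\<^sub>\<infinity>x\<in>S - {y}. q y x) * I y w"
      using state_in_S[OF t w] no_other[of "X t w"] A w by (auto simp: generator_def I_def)
  qed
  also have "\<dots> = (\<Sum>x\<in>A. q x y * \<P>(w in M. X t w = x))
      - (\<Sum>\<^sub>\<infinity>x\<in>S - {y}. q y x) * \<P>(w in M. X t w = y)"
    using I by simp
  finally show ?thesis
    using kolmogorov_forward[OF t y] by simp
qed

end

end

section \<open>Outflow and inflow of the Erlang queue\<close>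

lemma exit_rate_empty:
  assumes "k \<ge> 1"
  shows "(\<Sum>\<^sub>\<infinity>y\<in>erlang_states k - {(0, 0)}. erlang_rate k l \<mu> lam (0, 0) y) = (\<Sum>m=1..l. lam m)"
proof -
  have "(\<Sum>\<^sub>\<infinity>y\<in>erlang_states k - {(0, 0)}. erlang_rate k l \<mu> lam (0, 0) y)
      = (\<Sum>\<^sub>\<infinity>y\<in>(\<lambda>m. (m, k)) ` {1..l}. erlang_rate k l \<mu> lam (0, 0) y)"
    by (rule infsum_cong_neutral)
      (use assms in \<open>auto simp: erlang_states_def busy_states_def image_iff\<close>)
  also have "\<dots> = (\<Sum>y\<in>(\<lambda>m. (m, k)) ` {1..l}. erlang_rate k l \<mu> lam (0, 0) y)"
    by simp
  also have "\<dots> = (\<Sum>m=1..l. lam m)"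
    by (subst sum.reindex) (auto simp: inj_on_def)
  finally show ?thesis .
qed

fun service_target :: "nat \<Rightarrow> nat \<times> nat \<Rightarrow> nat \<times> nat" where
  "service_target k (n, s) =
    (if s \<ge> 2 then (n, s - 1) else if n \<ge> 2 then (n - 1, k) else (0, 0))"

lemma exit_rate_busy:
  assumes "(n, s) \<in> busy_states k"
  shows "(\<Sum>\<^sub>\<infinity>y\<in>erlang_states k - {(n, s)}. erlang_rate k l \<mu> lam (n, s) y)
    = (\<Sum>m=1..l. lam m) + k * \<mu>"
proof -
  have n: "1 \<le> n" "1 \<le> s" "s \<le> k" using assms by (auto simp: busy_states_def)
  have "(\<Sum>\<^sub>\<infinity>y\<in>erlang_states k - {(n, s)}. erlang_rate k l \<mu> lam (n, s) y)
      = (\<Sum>\<^sub>\<infinity>y\<in>(\<lambda>m. (n + m, s)) ` {1..l} \<union> {service_target k (n, s)}. erlang_rate k l \<mu> lam (n, s) y)"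
  proof (rule infsum_cong_neutral)
    fix y assume y: "y \<in> (erlang_states k - {(n, s)}) - ((\<lambda>m. (n + m, s)) ` {1..l} \<union> {service_target k (n, s)})"
    obtain n' s' where y': "y = (n', s')" by (cases y)
    have "\<not> (n + 1 \<le> n' \<and> n' \<le> n + l \<and> s' = s)"
    proof
      assume "n + 1 \<le> n' \<and> n' \<le> n + l \<and> s' = s"
      then have "y \<in> (\<lambda>m. (n + m, s)) ` {1..l}"
        unfolding y' by (intro image_eqI[of _ _ "n' - n"]) auto
      with y show False by blast
    qed
    then show "erlang_rate k l \<mu> lam (n, s) y = 0"
      using n y unfolding y' by auto
  next
    fix y assume y: "y \<in> ((\<lambda>m. (n + m, s)) ` {1..l} \<union> {service_target k (n, s)}) - (erlang_states k - {(n, s)})"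
    then show "erlang_rate k l \<mu> lam (n, s) y = 0"
      using n by (auto simp: erlang_states_def busy_states_def split: if_splits)
  qed simp
  also have "\<dots> = (\<Sum>y\<in>(\<lambda>m. (n + m, s)) ` {1..l} \<union> {service_target k (n, s)}. erlang_rate k l \<mu> lam (n, s) y)"
    by simp
  also have "\<dots> = (\<Sum>y\<in>(\<lambda>m. (n + m, s)) ` {1..l}. erlang_rate k l \<mu> lam (n, s) y)
      + erlang_rate k l \<mu> lam (n, s) (service_target k (n, s))"
    using n by (subst sum.union_disjoint) (auto split: if_splits)
  also have "(\<Sum>y\<in>(\<lambda>m. (n + m, s)) ` {1..l}. erlang_rate k l \<mu> lam (n, s) y) = (\<Sum>m=1..l. lam m)"
    using assms n by (subst sum.reindex) (auto simp: inj_on_def intro!: sum.cong)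
  also have "erlang_rate k l \<mu> lam (n, s) (service_target k (n, s)) = k * \<mu>"
    using n by auto
  finally show ?thesis .
qed

text \<open>
  The states that lead to a busy state \<open>(n, s)\<close> are of three kinds. A service event comes from
  \<open>service_source k n s\<close>. Arrivals come from the busy states in \<open>arrival_sources\<close>, where fewer than
  \<open>n\<close> customers arrive, or from the empty state. The latter is possible only in phase \<open>k\<close> and with
  all \<open>n\<close> customers arriving together.
\<close>
definition service_source :: "nat \<Rightarrow> nat \<Rightarrow> nat \<Rightarrow> nat \<times> nat" where
  "service_source k n s = (if s < k then (n, s + 1) else (n + 1, 1))"

definition arrival_sources :: "nat \<Rightarrow> nat \<Rightarrow> nat \<Rightarrow> (nat \<times> nat) set" where
  "arrival_sources l n s = (\<lambda>m. (n - m, s)) ` {1..min (n - 1) l}"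

definition empty_source :: "nat \<Rightarrow> nat \<Rightarrow> nat \<Rightarrow> nat \<Rightarrow> (nat \<times> nat) set" where
  "empty_source k l n s = (if s = k \<and> n \<le> l then {(0, 0)} else {})"

context
  fixes k l n s :: nat and \<mu> :: real and lam :: "nat \<Rightarrow> real"
  assumes busy: "1 \<le> n" "1 \<le> s" "s \<le> k"
begin

lemma sources_subset:
  "insert (service_source k n s) (arrival_sources l n s \<union> empty_source k l n s) \<subseteq> erlang_states k - {(n, s)}"
  using busy by (auto simp: service_source_def arrival_sources_def empty_source_def erlang_states_def busy_states_def)

lemma rate_from_other_state:
  assumes "x \<in> erlang_states k" "x \<noteq> (n, s)"
    "x \<notin> insert (service_source k n s) (arrival_sources l n s \<union> empty_source k l n s)"
  shows "erlang_rate k l \<mu> lam x (n, s) = 0"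
proof (cases x)
  case (Pair a b)
  have "\<not> ((a, b) \<in> busy_states k \<and> a + 1 \<le> n \<and> n \<le> a + l \<and> s = b)"
  proof
    assume *: "(a, b) \<in> busy_states k \<and> a + 1 \<le> n \<and> n \<le> a + l \<and> s = b"
    then have "x \<in> arrival_sources l n s"
      unfolding Pair arrival_sources_def
      by (intro image_eqI[of _ _ "n - a"]) (auto simp: busy_states_def)
    with assms show False by blast
  qed
  then show ?thesis
    using assms busy unfolding Pair
    by (auto simp: service_source_def empty_source_def erlang_states_def busy_states_def split: if_splits)
qed

lemma inflow_sum:
  fixes f :: "nat \<times> nat \<Rightarrow> real"
  shows "(\<Sum>x\<in>insert (service_source k n s) (arrival_sources l n s \<union> empty_source k l n s).
            erlang_rate k l \<mu> lam x (n, s) * f x)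
    = k * \<mu> * f (service_source k n s) + (\<Sum>m=1..min (n - 1) l. lam m * f (n - m, s))
      + (if s = k \<and> n \<le> l then lam n * f (0, 0) else 0)"
proof -
  let ?g = "\<lambda>x. erlang_rate k l \<mu> lam x (n, s) * f x"
  have fin: "finite (arrival_sources l n s)" "finite (empty_source k l n s)"
    by (auto simp: arrival_sources_def empty_source_def)
  have "sum ?g (insert (service_source k n s) (arrival_sources l n s \<union> empty_source k l n s))
     = ?g (service_source k n s) + (sum ?g (arrival_sources l n s) + sum ?g (empty_source k l n s))"
    using fin busy
    by (subst sum.insert, (auto simp: service_source_def arrival_sources_def empty_source_def)[2],
        subst sum.union_disjoint)
      (auto simp: arrival_sources_def empty_source_def)
  also have "?g (service_source k n s) = k * \<mu> * f (service_source k n s)"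
    using busy by (auto simp: service_source_def)
  also have "sum ?g (arrival_sources l n s) = (\<Sum>m=1..min (n - 1) l. lam m * f (n - m, s))"
    unfolding arrival_sources_def using busy
    by (subst sum.reindex) (auto simp: inj_on_def busy_states_def intro!: sum.cong)
  also have "sum ?g (empty_source k l n s) = (if s = k \<and> n \<le> l then lam n * f (0, 0) else 0)"
    using busy by (auto simp: empty_source_def)
  finally show ?thesis by simp
qed

end

section \<open>The difference-differential equations\<close>

context erlang_queue
begin

lemma prob_given_initial:
  assumes "t \<ge> 0"
  shows "\<P>(w in M. Q t w = y \<bar> Q 0 w = (0, 0)) = \<P>(w in M. Q t w = y)"
proof -
  have "\<P>(w in M. Q 0 w = (0, 0)) = 1"
    using initial_state events_state[of 0 "\<lambda>x. x = (0, 0)"] by (simp add: prob_Collect_eq_1)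
  moreover have "\<P>(w in M. Q t w = y \<and> Q 0 w = (0, 0)) = \<P>(w in M. Q t w = y)"
    using initial_state assms
    by (intro finite_measure_eq_AE sets.sets_Collect_conj events_state) auto
  ultimately show ?thesis by (simp add: cond_prob_def)
qed

context
  assumes k_pos: "k \<ge> 1" and \<mu>_nonneg: "\<mu> \<ge> 0"
    and lam_nonneg: "\<And>m. 1 \<le> m \<Longrightarrow> m \<le> l \<Longrightarrow> lam m \<ge> 0"
begin

text \<open>
  Busy states have the largest exit rate, \<open>\<Lambda> + k\<mu>\<close>. Adding 1 makes the bound strict, as the forward
  equation requires.
\<close>
lemma exit_rate_bound:
  assumes "x \<in> erlang_states k"
  shows "(\<Sum>\<^sub>\<infinity>y\<in>erlang_states k - {x}. erlang_rate k l \<mu> lam x y) < (\<Sum>m=1..l. lam m) + k * \<mu> + 1"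
  using assms \<mu>_nonneg exit_rate_empty[OF k_pos, of l \<mu> lam] exit_rate_busy[of "fst x" "snd x" k l \<mu> lam]
  by (cases "x = (0, 0)") (auto simp: erlang_states_def intro!: add_nonneg_pos mult_nonneg_nonneg)

lemma bound_nonneg: "(\<Sum>m=1..l. lam m) + k * \<mu> + 1 \<ge> 0"
  using \<mu>_nonneg lam_nonneg by (intro add_nonneg_nonneg sum_nonneg) auto

lemma empty_prob_derivative:
  assumes t: "t \<ge> 0"
  shows "((\<lambda>t. \<P>(w in M. Q t w = (0, 0))) has_real_derivative
      (k * \<mu> * \<P>(w in M. Q t w = (1, 1)) - (\<Sum>m=1..l. lam m) * \<P>(w in M. Q t w = (0, 0))))
      (at t within {0..})"
proof -
  have "erlang_rate k l \<mu> lam x (0, 0) = 0" if "x \<in> erlang_states k" "x \<noteq> (0, 0)" "x \<noteq> (1, 1)" for x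
    using that k_pos by (cases x) (auto simp: erlang_states_def busy_states_def)
  moreover have "(0, 0) \<in> erlang_states k" "{(1, 1)} \<subseteq> erlang_states k - {(0, 0)}"
    using k_pos by (auto simp: erlang_states_def busy_states_def)
  ultimately have "((\<lambda>t. \<P>(w in M. Q t w = (0, 0))) has_real_derivative
      ((\<Sum>x\<in>{(1, 1)}. erlang_rate k l \<mu> lam x (0, 0) * \<P>(w in M. Q t w = x))
        - (\<Sum>\<^sub>\<infinity>x\<in>erlang_states k - {(0, 0)}. erlang_rate k l \<mu> lam (0, 0) x) * \<P>(w in M. Q t w = (0, 0))))
      (at t within {0..})"
    by (intro kolmogorov_forward_finite[OF rates exit_rate_bound bound_nonneg t]) auto
  then show ?thesis
    by (simp add: exit_rate_empty[OF k_pos])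
qed

lemma busy_prob_derivative:
  assumes t: "t \<ge> 0" and n: "1 \<le> n" "1 \<le> s" "s \<le> k"
  shows "((\<lambda>t. \<P>(w in M. Q t w = (n, s))) has_real_derivative
      (k * \<mu> * \<P>(w in M. Q t w = service_source k n s)
        + (\<Sum>m=1..min (n - 1) l. lam m * \<P>(w in M. Q t w = (n - m, s)))
        + (if s = k \<and> n \<le> l then lam n * \<P>(w in M. Q t w = (0, 0)) else 0)
        - ((\<Sum>m=1..l. lam m) + k * \<mu>) * \<P>(w in M. Q t w = (n, s))))
      (at t within {0..})"
proof -
  have b: "(n, s) \<in> busy_states k" using n by (simp add: busy_states_def)
  then have S: "(n, s) \<in> erlang_states k" by (simp add: erlang_states_def)
  have fin: "finite (insert (service_source k n s) (arrival_sources l n s \<union> empty_source k l n s))"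
    by (auto simp: arrival_sources_def empty_source_def)
  let ?A = "insert (service_source k n s) (arrival_sources l n s \<union> empty_source k l n s)"
  have "((\<lambda>t. \<P>(w in M. Q t w = (n, s))) has_real_derivative
      ((\<Sum>x\<in>?A. erlang_rate k l \<mu> lam x (n, s) * \<P>(w in M. Q t w = x))
        - (\<Sum>\<^sub>\<infinity>x\<in>erlang_states k - {(n, s)}. erlang_rate k l \<mu> lam (n, s) x) * \<P>(w in M. Q t w = (n, s))))
      (at t within {0..})"
    by (rule kolmogorov_forward_finite[OF rates exit_rate_bound bound_nonneg t S fin
        sources_subset[OF n] rate_from_other_state[OF n]])
  then show ?thesis
    unfolding inflow_sum[OF n] exit_rate_busy[OF b] .
qed

end
end

theorem theorem2p1:
  fixes M :: "'w measure"
    and Q :: "real \<Rightarrow> 'w \<Rightarrow> nat \<times> nat"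
    and k l :: nat
    and \<mu> \<Lambda> :: real
    and lam c :: "nat \<Rightarrow> real"
    and p0 :: "real \<Rightarrow> real"
    and p :: "nat \<Rightarrow> nat \<Rightarrow> real \<Rightarrow> real"
  assumes "k \<ge> 1" and "l \<ge> 1" and "\<mu> > 0"
    and "\<And>m. 1 \<le> m \<Longrightarrow> m \<le> l \<Longrightarrow> lam m > 0"
    and "\<Lambda> = (\<Sum>m=1..l. lam m)"
    and "\<And>m. 1 \<le> m \<Longrightarrow> m \<le> l \<Longrightarrow> c m = lam m / \<Lambda>"
    and "erlang_queue M k l \<mu> lam Q"
    and "p0 = empty_prob M Q"
    and "p = state_phase_prob M Q"
  shows
    "(\<forall>t\<ge>0.
      (p0 has_real_derivative
        (- \<Lambda> * p0 t + k * \<mu> * p 1 1 t)) (at t within {0..}) \<and>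
      (\<forall>s. 1 \<le> s \<and> s \<le> k - 1 \<longrightarrow>
        (p 1 s has_real_derivative
          (- (\<Lambda> + k * \<mu>) * p 1 s t + k * \<mu> * p 1 (s + 1) t)) (at t within {0..})) \<and>
      (p 1 k has_real_derivative
        (- (\<Lambda> + k * \<mu>) * p 1 k t + k * \<mu> * p 2 1 t + \<Lambda> * c 1 * p0 t)) (at t within {0..}) \<and>
      (\<forall>n s. 1 \<le> s \<and> s \<le> k - 1 \<and> 2 \<le> n \<longrightarrow>
        (p n s has_real_derivative
          (- (\<Lambda> + k * \<mu>) * p n s t + k * \<mu> * p n (s + 1) t
            + \<Lambda> * (\<Sum>m=1..min n l. c m * p (n - m) s t))) (at t within {0..})) \<and>
      (\<forall>n. 2 \<le> n \<and> n \<le> l \<longrightarrow>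
        (p n k has_real_derivative
          (- (\<Lambda> + k * \<mu>) * p n k t + k * \<mu> * p (n + 1) 1 t
            + \<Lambda> * (\<Sum>m=1..n-1. c m * p (n - m) k t) + \<Lambda> * c n * p0 t)) (at t within {0..})) \<and>
      (\<forall>n. n > l \<longrightarrow>
        (p n k has_real_derivative
          (- (\<Lambda> + k * \<mu>) * p n k t + k * \<mu> * p (n + 1) 1 t
            + \<Lambda> * (\<Sum>m=1..l. c m * p (n - m) k t))) (at t within {0..}))) \<and>
     p0 0 = 1 \<and> (\<forall>n s. 1 \<le> s \<and> s \<le> k \<and> 1 \<le> n \<longrightarrow> p n s 0 = 0)"
proof -
  interpret erlang_queue M k l \<mu> lam Q by fact
  \<comment> \<open>Off \<open>{0..}\<close> the process is arbitrary, so \<open>p0\<close> and \<open>p\<close> are sure to agree with \<open>\<nu>\<close> only for \<open>t \<ge> 0\<close>.\<close>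
  define \<nu> where "\<nu> x t = \<P>(w in M. Q t w = x)" for x t
  have p0: "p0 t = \<nu> (0, 0) t" if "t \<ge> 0" for t
    using that by (simp add: assms(8) empty_prob_def prob_given_initial \<nu>_def)
  have p: "p n s t = \<nu> (n, s) t" if "t \<ge> 0" "n \<ge> 1" for n s t
    using that by (simp add: assms(9) state_phase_prob_def prob_given_initial \<nu>_def)
  have p_zero: "p 0 s t = 0" for s t
    by (simp add: assms(9) state_phase_prob_def)
  have \<Lambda>: "\<Lambda> > 0"
    unfolding assms(5) using assms(2,4) by (intro sum_pos) auto
  have c: "\<Lambda> * c m = lam m" if "1 \<le> m" "m \<le> l" for m
    using assms(6)[OF that] \<Lambda> by simp
  have lam: "lam m \<ge> 0" if "1 \<le> m" "m \<le> l" for m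
    using assms(4)[OF that] by simp
  have c_sum: "\<Lambda> * (\<Sum>m=1..N. c m * f m) = (\<Sum>m=1..N. lam m * f m)" if "N \<le> l" for N f
    unfolding sum_distrib_left using that by (intro sum.cong) (auto simp flip: c)
  have d0: "(p0 has_real_derivative (- \<Lambda> * p0 t + k * \<mu> * p 1 1 t)) (at t within {0..})"
    if t: "t \<ge> 0" for t
  proof (rule has_field_derivative_transform_within[where d = 1 and f = "\<nu> (0, 0)"])
    show "(\<nu> (0, 0) has_real_derivative (- \<Lambda> * p0 t + k * \<mu> * p 1 1 t)) (at t within {0..})"
    proof -
      have "(\<nu> (0, 0) has_real_derivative (k * \<mu> * \<nu> (1, 1) t - \<Lambda> * \<nu> (0, 0) t)) (at t within {0..})"
        unfolding \<nu>_def[abs_def] assms(5)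
        by (rule empty_prob_derivative[OF assms(1) less_imp_le[OF assms(3)] lam t])
      then show ?thesis using t by (simp add: p0 p)
    qed
  qed (use t p0 in auto)
  \<comment> \<open>All equations for busy states are cases of this one, according to whether \<open>s < k\<close>
    and how \<open>n\<close> compares with \<open>1\<close> and \<open>l\<close>.\<close>
  have d: "(p n s has_real_derivative
      (- (\<Lambda> + k * \<mu>) * p n s t + k * \<mu> * (if s < k then p n (s + 1) t else p (n + 1) 1 t)
        + (\<Sum>m=1..min (n - 1) l. lam m * p (n - m) s t)
        + (if s = k \<and> n \<le> l then lam n * p0 t else 0))) (at t within {0..})"
    if t: "t \<ge> 0" and n: "1 \<le> n" "1 \<le> s" "s \<le> k" for n s t
  proof (rule has_field_derivative_transform_within[where d = 1 and f = "\<nu> (n, s)"])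
    have D: "(\<nu> (n, s) has_real_derivative
      (k * \<mu> * \<nu> (service_source k n s) t + (\<Sum>m=1..min (n - 1) l. lam m * \<nu> (n - m, s) t)
        + (if s = k \<and> n \<le> l then lam n * \<nu> (0, 0) t else 0)
        - (\<Lambda> + k * \<mu>) * \<nu> (n, s) t)) (at t within {0..})"
      unfolding \<nu>_def[abs_def] assms(5)
      by (rule busy_prob_derivative[OF assms(1) less_imp_le[OF assms(3)] lam t n])
    have arrivals: "(\<Sum>m=1..min (n - 1) l. lam m * \<nu> (n - m, s) t)
        = (\<Sum>m=1..min (n - 1) l. lam m * p (n - m) s t)"
      using t n by (intro sum.cong) (auto simp: p)
    have service: "\<nu> (service_source k n s) t = (if s < k then p n (s + 1) t else p (n + 1) 1 t)"
      using t n by (auto simp: service_source_def p)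
    show "(\<nu> (n, s) has_real_derivative
      (- (\<Lambda> + k * \<mu>) * p n s t + k * \<mu> * (if s < k then p n (s + 1) t else p (n + 1) 1 t)
        + (\<Sum>m=1..min (n - 1) l. lam m * p (n - m) s t)
        + (if s = k \<and> n \<le> l then lam n * p0 t else 0))) (at t within {0..})"
      using D unfolding arrivals service p[OF t n(1), symmetric] p0[OF t, symmetric]
      by (rule DERIV_cong) (simp add: distrib_right left_diff_distrib)
  qed (use t n p in auto)
  show ?thesis
  proof (intro conjI allI impI; (elim conjE)?)
    fix t :: real assume t: "t \<ge> 0"
    show "(p0 has_real_derivative (- \<Lambda> * p0 t + k * \<mu> * p 1 1 t)) (at t within {0..})"
      by (rule d0[OF t])
    show "(p 1 s has_real_derivative
          (- (\<Lambda> + k * \<mu>) * p 1 s t + k * \<mu> * p 1 (s + 1) t)) (at t within {0..})"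
      if "1 \<le> s" "s \<le> k - 1" for s
    proof -
      have "s < k" using that assms(1) by linarith
      then show ?thesis using d[OF t, of 1 s] that by simp
    qed
    show "(p 1 k has_real_derivative
        (- (\<Lambda> + k * \<mu>) * p 1 k t + k * \<mu> * p 2 1 t + \<Lambda> * c 1 * p0 t)) (at t within {0..})"
      using d[OF t, of 1 k] assms(1,2) c[of 1] by (simp add: numeral_2_eq_2)
    show "(p n s has_real_derivative
          (- (\<Lambda> + k * \<mu>) * p n s t + k * \<mu> * p n (s + 1) t
            + \<Lambda> * (\<Sum>m=1..min n l. c m * p (n - m) s t))) (at t within {0..})"
      if s: "1 \<le> s" "s \<le> k - 1" and n: "2 \<le> n" for n s
    proof -
      \<comment> \<open>The summand \<open>m = n\<close> would be an arrival at the empty system, which leads to phase \<open>k\<close> only;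
        it vanishes by the convention \<open>p 0 s t = 0\<close>.\<close>
      have "(\<Sum>m=1..min n l. lam m * p (n - m) s t) = (\<Sum>m=1..min (n - 1) l. lam m * p (n - m) s t)"
        by (rule sum.mono_neutral_right) (auto simp: p_zero min_def not_le split: if_splits)
      moreover have "s < k" using s assms(1) by linarith
      ultimately show ?thesis
        using d[OF t, of n s] s n c_sum[of "min n l" "\<lambda>m. p (n - m) s t"] by simp
    qed
    show "(p n k has_real_derivative
          (- (\<Lambda> + k * \<mu>) * p n k t + k * \<mu> * p (n + 1) 1 t
            + \<Lambda> * (\<Sum>m=1..n-1. c m * p (n - m) k t) + \<Lambda> * c n * p0 t)) (at t within {0..})"
      if n: "2 \<le> n" "n \<le> l" for n
      using d[OF t, of n k] n assms(1) c_sum[of "n - 1" "\<lambda>m. p (n - m) k t"] c[of n]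
      by (simp add: min_absorb1)
    show "(p n k has_real_derivative
          (- (\<Lambda> + k * \<mu>) * p n k t + k * \<mu> * p (n + 1) 1 t
            + \<Lambda> * (\<Sum>m=1..l. c m * p (n - m) k t))) (at t within {0..})"
      if n: "n > l" for n
      using d[OF t, of n k] n assms(1) c_sum[of l "\<lambda>m. p (n - m) k t"]
      by (simp add: min_absorb2)
  next
    have 1: "\<nu> (0, 0) 0 = 1"
      using initial_state events_state[of 0 "\<lambda>x. x = (0, 0)"] by (simp add: \<nu>_def prob_Collect_eq_1)
    then show "p0 0 = 1" by (simp add: p0)
    fix n s :: nat assume "1 \<le> n"
    have "AE w in M. \<not> Q 0 w = (n, s)"
      using initial_state by (rule eventually_mono) (use \<open>1 \<le> n\<close> in auto)
    then have "\<nu> (n, s) 0 = 0"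
      using events_state[of 0 "\<lambda>x. x = (n, s)"] unfolding \<nu>_def by (subst prob_Collect_eq_0) auto
    then show "p n s 0 = 0" using \<open>1 \<le> n\<close> by (simp add: p)
  qed
qed

end
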